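(* Let $G$ be a group, $A$ a $G$-module, and let $\alpha,\beta\in ZS^3(G,A)$. There exists an isomorphism of $\Delta$-groups $f:T(G,A,\alpha)\to T(G,A,\beta)$ of the form $$f((a,(g,h^{-1})))=(a+\sigma(g^{-1}h,h^{-1}),(g,h^{-1}))\qquad (a\in A,\ g,h\in G)$$ for some map $\sigma:G\times G\to A$ if and only if $[\alpha]=[\beta]$ in $HS^3(G,A)$.
   Context: **$\Delta$-groups.** Let $G$ be a group. A $\Delta$-group based at $G$ is a collection of sets $T=\{T(g,h)\}_{g,h\in G}$ with operations, for all $g,h,k\in G$, $$m:T(g,h^{-1})\times T(h,k^{-1})\times T(h^{-1}g,k^{-1}h)\to T(g,k^{-1}),$$ $$P:T(g,h)\to T(h,g^{-1}h^{-1}),\qquad Q:T(g,h)\to T(g^{-1},hg),$$ such that, whenever the expressions are defined, (1) $P^3=\mathrm{id}$, $Q^2=\mathrm{id}$, $P^2Q=QP$; (2) $P(m(a,b,c))=m(P(b),P(c),P(a))$; (3) $Q(m(a,b,c))=m(Q(a),Q(c),Q(b))$; (4) $m(m(a,b,c),d,e)=m(a,m(b,d,f),m(c,Q(f),e))$, for $a\in T(g,h^{-1})$, $b\in T(h,k^{-1})$, $c\in T(h^{-1}g,k^{-1}h)$, $d\in T(k,l^{-1})$, $e\in T(k^{-1}g,l^{-1}k)$, $f\in T(k^{-1}h,l^{-1}k)$; (5) $m(m(f,a,b),P^2Q(a),PQ(b))=f$, for $f\in T(g,h^{-1})$, $a\in T(h,k^{-1})$, $b\in T(h^{-1}g,k^{-1}h)$.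 An isomorphism of $\Delta$-groups $T\to T'$ based at the same group $G$ is a family of bijections $T(g,h)\to T'(g,h)$ commuting with $m,P,Q$. **$T(G,A,\alpha)$.** For $\alpha:G^3\to A$ it is the collection of sets $T(g,h)=\{(a,(g,h)):a\in A\}$ with $$m\big((a,(g,h^{-1})),(b,(h,k^{-1})),(c,(h^{-1}g,k^{-1}h))\big)=\big(a+(g^{-1}h)b+c+\alpha(g^{-1}h,h^{-1}k,k^{-1}),(g,k^{-1})\big),$$ $$P((a,(g,h^{-1})))=(ga,(h^{-1},g^{-1}h)),\qquad Q((a,(g,h^{-1})))=(-ga,(g^{-1},h^{-1}g)).$$ It is a $\Delta$-group when $\alpha\in ZS^3(G,A)$. **Symmetric cohomology in degree 3.** Let $C^n(G,A)$ be the group of all maps $G^n\to A$ with the usual inhomogeneous coboundary $\partial$. $CS^2(G,A)$ is the subgroup of $\sigma\in C^2(G,A)$ with $\sigma(x,y)=-x\sigma(x^{-1},xy)=-\sigma(xy,y^{-1})$ for all $x,y\in G$. $CS^3(G,A)$ is the subgroup of $\alpha\in C^3(G,A)$ with $\alpha(x,y,z)=-x\alpha(x^{-1},xy,z)=-\alpha(xy,y^{-1},yz)=-\alpha(x,yz,z^{-1})$ for all $x,y,z\in G$. $ZS^3(G,A)$ is the group of $\alpha\in CS^3(G,A)$ with $\partial\alpha=0$, $BS^3(G,A)=\partial(CS^2(G,A))$, and $HS^3(G,A)=ZS^3(G,A)/BS^3(G,A)$. *)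

theory Defs
  imports "HOL-Algebra.Algebra"
begin

section \<open>Symmetric cohomology in degree 3\<close>

text \<open>The abelian group \<open>A\<close> is written additively, so it is represented by the additive part of a
  ring record; its multiplicative fields are never used. The library's \<open>group_action\<close> takes the
  maps \<open>act g\<close> to be extensional on \<open>carrier A\<close>, which only fixes junk values.\<close>

locale G_module = group G + abelian_group A + group_action G "carrier A" act
  for G :: "('g, 'm) monoid_scheme" (structure)
    and A :: "('a, 'r) ring_scheme" (structure)
    and act :: "'g \<Rightarrow> 'a \<Rightarrow> 'a" +
  assumes act_add:
    "\<lbrakk>g \<in> carrier G; a \<in> carrier A; b \<in> carrier A\<rbrakk>
      \<Longrightarrow> act g (a \<oplus>\<^bsub>A\<^esub> b) = act g a \<oplus>\<^bsub>A\<^esub> act g b"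
begin

text \<open>\<open>G\<^sup>n\<close> is the set of lists of length \<open>n\<close>; cochains are extensional, so that equality of cochains
  is equality as maps on \<open>G\<^sup>n\<close>.\<close>

definition tuples :: "nat \<Rightarrow> 'g list set"
  where "tuples n = {xs. set xs \<subseteq> carrier G \<and> length xs = n}"

definition cochains :: "nat \<Rightarrow> ('g list \<Rightarrow> 'a) monoid"
  where "cochains n =
    \<lparr>carrier = tuples n \<rightarrow>\<^sub>E carrier A,
     monoid.mult = (\<lambda>\<sigma> \<tau>. \<lambda>xs\<in>tuples n. \<sigma> xs \<oplus>\<^bsub>A\<^esub> \<tau> xs),
     one = (\<lambda>xs\<in>tuples n. \<zero>\<^bsub>A\<^esub>)\<rparr>"

definition alternate :: "nat \<Rightarrow> 'a \<Rightarrow> 'a"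
  where "alternate i a = (if even i then a else \<ominus>\<^bsub>A\<^esub> a)"

text \<open>\<open>merge i [x\<^sub>1, \<dots>, x\<^sub>m] = [x\<^sub>1, \<dots>, x\<^sub>i x\<^sub>i\<^sub>+\<^sub>1, \<dots>, x\<^sub>m]\<close> for \<open>1 \<le> i < m\<close>; list positions count from 0.\<close>

definition merge :: "nat \<Rightarrow> 'g list \<Rightarrow> 'g list"
  where "merge i xs = take (i - 1) xs @ (xs ! (i - 1) \<otimes> xs ! i) # drop (i + 1) xs"

text \<open>\<open>coboundary n\<close> is the inhomogeneous coboundary \<open>C\<^sup>n \<rightarrow> C\<^sup>n\<^sup>+\<^sup>1\<close>.\<close>

definition coboundary :: "nat \<Rightarrow> ('g list \<Rightarrow> 'a) \<Rightarrow> ('g list \<Rightarrow> 'a)"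
  where "coboundary n \<sigma> = (\<lambda>xs\<in>tuples (n + 1).
    act (hd xs) (\<sigma> (tl xs))
    \<oplus>\<^bsub>A\<^esub> (\<Oplus>\<^bsub>A\<^esub>i\<in>{1..n}. alternate i (\<sigma> (merge i xs)))
    \<oplus>\<^bsub>A\<^esub> alternate (n + 1) (\<sigma> (butlast xs)))"

definition CS2 :: "('g list \<Rightarrow> 'a) set"
  where "CS2 = {\<sigma> \<in> carrier (cochains 2). \<forall>x\<in>carrier G. \<forall>y\<in>carrier G.
    \<sigma> [x, y] = \<ominus>\<^bsub>A\<^esub> act x (\<sigma> [inv x, x \<otimes> y]) \<and>
    \<sigma> [x, y] = \<ominus>\<^bsub>A\<^esub> \<sigma> [x \<otimes> y, inv y]}"

definition CS3 :: "('g list \<Rightarrow> 'a) set"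
  where "CS3 = {\<alpha> \<in> carrier (cochains 3). \<forall>x\<in>carrier G. \<forall>y\<in>carrier G. \<forall>z\<in>carrier G.
    \<alpha> [x, y, z] = \<ominus>\<^bsub>A\<^esub> act x (\<alpha> [inv x, x \<otimes> y, z]) \<and>
    \<alpha> [x, y, z] = \<ominus>\<^bsub>A\<^esub> \<alpha> [x \<otimes> y, inv y, y \<otimes> z] \<and>
    \<alpha> [x, y, z] = \<ominus>\<^bsub>A\<^esub> \<alpha> [x, y \<otimes> z, inv z]}"

definition ZS3 :: "('g list \<Rightarrow> 'a) monoid"
  where "ZS3 = (cochains 3)
    \<lparr>carrier := {\<alpha> \<in> CS3. coboundary 3 \<alpha> = \<one>\<^bsub>cochains 4\<^esub>}\<rparr>"

definition BS3 :: "('g list \<Rightarrow> 'a) set"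
  where "BS3 = coboundary 2 ` CS2"

definition HS3 :: "('g list \<Rightarrow> 'a) set monoid"
  where "HS3 = ZS3 Mod BS3"

definition HS3_class :: "('g list \<Rightarrow> 'a) \<Rightarrow> ('g list \<Rightarrow> 'a) set"
  where "HS3_class \<alpha> = BS3 #>\<^bsub>ZS3\<^esub> \<alpha>"

lemma HS3_class_in_HS3: "\<alpha> \<in> carrier ZS3 \<Longrightarrow> HS3_class \<alpha> \<in> carrier HS3"
  by (auto simp: HS3_def HS3_class_def carrier_FactGroup)

end


section \<open>\<open>\<Delta>\<close>-groups\<close>

text \<open>The sets \<open>T(g,h)\<close> need not be disjoint, so each operation carries its indices:
  \<open>\<m> D g h k\<close> is the operation on \<open>T(g,h\<^sup>-\<^sup>1) \<times> T(h,k\<^sup>-\<^sup>1) \<times> T(h\<^sup>-\<^sup>1g,k\<^sup>-\<^sup>1h)\<close>, while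
  \<open>\<P> D g h\<close> and \<open>\<Q> D g h\<close> are the operations on \<open>T(g,h)\<close>.\<close>

record ('g, 't) delta_data =
  \<T> :: "'g \<Rightarrow> 'g \<Rightarrow> 't set"
  \<m> :: "'g \<Rightarrow> 'g \<Rightarrow> 'g \<Rightarrow> 't \<Rightarrow> 't \<Rightarrow> 't \<Rightarrow> 't"
  \<P> :: "'g \<Rightarrow> 'g \<Rightarrow> 't \<Rightarrow> 't"
  \<Q> :: "'g \<Rightarrow> 'g \<Rightarrow> 't \<Rightarrow> 't"

text \<open>The indices of the operations in the axioms are forced by the positions of the arguments;
  for example, if \<open>x \<in> T(g,h)\<close> then \<open>P(x) \<in> T(h,g\<^sup>-\<^sup>1h\<^sup>-\<^sup>1)\<close> and \<open>P(P(x)) \<in> T(g\<^sup>-\<^sup>1h\<^sup>-\<^sup>1,g)\<close>.\<close>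

locale delta_group = group G
  for G :: "('g, 'm) monoid_scheme" (structure)
    and D :: "('g, 't) delta_data" +
  assumes m_closed:
    "\<lbrakk>g \<in> carrier G; h \<in> carrier G; k \<in> carrier G;
      a \<in> \<T> D g (inv h); b \<in> \<T> D h (inv k); c \<in> \<T> D (inv h \<otimes> g) (inv k \<otimes> h)\<rbrakk>
      \<Longrightarrow> \<m> D g h k a b c \<in> \<T> D g (inv k)"
  and P_closed:
    "\<lbrakk>g \<in> carrier G; h \<in> carrier G; x \<in> \<T> D g h\<rbrakk> \<Longrightarrow> \<P> D g h x \<in> \<T> D h (inv g \<otimes> inv h)"
  and Q_closed:
    "\<lbrakk>g \<in> carrier G; h \<in> carrier G; x \<in> \<T> D g h\<rbrakk> \<Longrightarrow> \<Q> D g h x \<in> \<T> D (inv g) (h \<otimes> g)"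
  and P_cubed:
    "\<lbrakk>g \<in> carrier G; h \<in> carrier G; x \<in> \<T> D g h\<rbrakk>
      \<Longrightarrow> \<P> D (inv g \<otimes> inv h) g (\<P> D h (inv g \<otimes> inv h) (\<P> D g h x)) = x"
  and Q_squared:
    "\<lbrakk>g \<in> carrier G; h \<in> carrier G; x \<in> \<T> D g h\<rbrakk> \<Longrightarrow> \<Q> D (inv g) (h \<otimes> g) (\<Q> D g h x) = x"
  and PPQ_eq_QP:
    "\<lbrakk>g \<in> carrier G; h \<in> carrier G; x \<in> \<T> D g h\<rbrakk>
      \<Longrightarrow> \<P> D (h \<otimes> g) (inv h) (\<P> D (inv g) (h \<otimes> g) (\<Q> D g h x)) = \<Q> D h (inv g \<otimes> inv h) (\<P> D g h x)"
  and P_m: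
    "\<lbrakk>g \<in> carrier G; h \<in> carrier G; k \<in> carrier G;
      a \<in> \<T> D g (inv h); b \<in> \<T> D h (inv k); c \<in> \<T> D (inv h \<otimes> g) (inv k \<otimes> h)\<rbrakk>
      \<Longrightarrow> \<P> D g (inv k) (\<m> D g h k a b c) =
          \<m> D (inv k) (inv k \<otimes> h) (inv k \<otimes> g)
            (\<P> D h (inv k) b) (\<P> D (inv h \<otimes> g) (inv k \<otimes> h) c) (\<P> D g (inv h) a)"
  and Q_m:
    "\<lbrakk>g \<in> carrier G; h \<in> carrier G; k \<in> carrier G;
      a \<in> \<T> D g (inv h); b \<in> \<T> D h (inv k); c \<in> \<T> D (inv h \<otimes> g) (inv k \<otimes> h)\<rbrakk>
      \<Longrightarrow> \<Q> D g (inv k) (\<m> D g h k a b c) =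
          \<m> D (inv g) (inv g \<otimes> h) (inv g \<otimes> k)
            (\<Q> D g (inv h) a) (\<Q> D (inv h \<otimes> g) (inv k \<otimes> h) c) (\<Q> D h (inv k) b)"
  and m_assoc4:
    "\<lbrakk>g \<in> carrier G; h \<in> carrier G; k \<in> carrier G; l \<in> carrier G;
      a \<in> \<T> D g (inv h); b \<in> \<T> D h (inv k); c \<in> \<T> D (inv h \<otimes> g) (inv k \<otimes> h);
      d \<in> \<T> D k (inv l); e \<in> \<T> D (inv k \<otimes> g) (inv l \<otimes> k); f \<in> \<T> D (inv k \<otimes> h) (inv l \<otimes> k)\<rbrakk>
      \<Longrightarrow> \<m> D g k l (\<m> D g h k a b c) d e =
          \<m> D g h l a (\<m> D h k l b d f)
            (\<m> D (inv h \<otimes> g) (inv h \<otimes> k) (inv h \<otimes> l) c (\<Q> D (inv k \<otimes> h) (inv l \<otimes> k) f) e)"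
  and m_cancel:
    "\<lbrakk>g \<in> carrier G; h \<in> carrier G; k \<in> carrier G;
      f \<in> \<T> D g (inv h); a \<in> \<T> D h (inv k); b \<in> \<T> D (inv h \<otimes> g) (inv k \<otimes> h)\<rbrakk>
      \<Longrightarrow> \<m> D g k h (\<m> D g h k f a b)
            (\<P> D (inv k \<otimes> h) k (\<P> D (inv h) (inv k \<otimes> h) (\<Q> D h (inv k) a)))
            (\<P> D (inv g \<otimes> h) (inv k \<otimes> g) (\<Q> D (inv h \<otimes> g) (inv k \<otimes> h) b)) = f"

locale delta_group_iso =
  source: delta_group G D + target: delta_group G D'
  for G :: "('g, 'm) monoid_scheme" (structure)
    and D :: "('g, 't) delta_data" and D' :: "('g, 'u) delta_data" +
  fixes f :: "'g \<Rightarrow> 'g \<Rightarrow> 't \<Rightarrow> 'u"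
  assumes bij: "\<lbrakk>g \<in> carrier G; h \<in> carrier G\<rbrakk> \<Longrightarrow> bij_betw (f g h) (\<T> D g h) (\<T> D' g h)"
  and commutes_m:
    "\<lbrakk>g \<in> carrier G; h \<in> carrier G; k \<in> carrier G;
      a \<in> \<T> D g (inv h); b \<in> \<T> D h (inv k); c \<in> \<T> D (inv h \<otimes> g) (inv k \<otimes> h)\<rbrakk>
      \<Longrightarrow> f g (inv k) (\<m> D g h k a b c) =
          \<m> D' g h k (f g (inv h) a) (f h (inv k) b) (f (inv h \<otimes> g) (inv k \<otimes> h) c)"
  and commutes_P:
    "\<lbrakk>g \<in> carrier G; h \<in> carrier G; x \<in> \<T> D g h\<rbrakk>
      \<Longrightarrow> f h (inv g \<otimes> inv h) (\<P> D g h x) = \<P> D' g h (f g h x)"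
  and commutes_Q:
    "\<lbrakk>g \<in> carrier G; h \<in> carrier G; x \<in> \<T> D g h\<rbrakk>
      \<Longrightarrow> f (inv g) (h \<otimes> g) (\<Q> D g h x) = \<Q> D' g h (f g h x)"


subsection \<open>The \<open>\<Delta>\<close>-group \<open>T(G,A,\<alpha>)\<close>\<close>

context G_module
begin

text \<open>The formulas for \<open>P\<close> and \<open>Q\<close> are commonly stated on \<open>T(g,h\<^sup>-\<^sup>1)\<close>; below, \<open>h\<close> replaces \<open>h\<^sup>-\<^sup>1\<close>.\<close>

definition T_alpha :: "('g list \<Rightarrow> 'a) \<Rightarrow> ('g, 'a \<times> ('g \<times> 'g)) delta_data"
  where "T_alpha \<alpha> =
    \<lparr>\<T> = (\<lambda>g h. {(a, (g, h)) | a. a \<in> carrier A}),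
     \<m> = (\<lambda>g h k (a, _) (b, _) (c, _).
       (a \<oplus>\<^bsub>A\<^esub> act (inv g \<otimes> h) b \<oplus>\<^bsub>A\<^esub> c \<oplus>\<^bsub>A\<^esub> \<alpha> [inv g \<otimes> h, inv h \<otimes> k, inv k], (g, inv k))),
     \<P> = (\<lambda>g h (a, _). (act g a, (h, inv g \<otimes> inv h))),
     \<Q> = (\<lambda>g h (a, _). (\<ominus>\<^bsub>A\<^esub> act g a, (inv g, h \<otimes> g)))\<rparr>"

end

end

theory Submission
  imports Defs
begin

text \<open>A translation of the fibres by \<open>\<sigma>\<close> commutes with \<open>P\<close> and \<open>Q\<close> iff \<open>\<sigma>\<close>, read as an equivariant
  function on triples \<open>(1, x, xy)\<close>, alternates under a 3-cycle and a transposition of the vertices,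
  that is, iff \<open>\<sigma> \<in> CS2\<close>. Given this, commuting with \<open>m\<close> says precisely
  \<open>\<alpha> = coboundary 2 \<sigma> + \<beta>\<close>.\<close>

text \<open>Let \<phi> be the equivariant function with \<phi>(1, x, xy) = \<sigma>[x, y]. The shift
  on T(g, h^-1) is then g^-1 \<phi>(g, h, 1): the fibre sits over the triangle (g, h, 1), seen from
  its vertex g. This is why \<open>P\<close> and \<open>Q\<close> multiply by g: the factor g^-1
  disappears and only a permutation of the vertices is left. In the same way m sends the faces (g,
  h, 1), (h, k, 1), (g, k, h) of the tetrahedron (g, h, k, 1) to its remaining face (g, k, 1), and
  \<alpha> contributes g^-1 times its value on the tetrahedron. Axiom (4) compares two tetrahedra
  with three, which together bound the 4-simplex (g, h, k, l, 1); this is the cocycle identity. The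
  obstacle throughout is order: the operations list vertices differently from the coboundary, so
  terms can be compared only after alternation has reordered them.\<close>

lemma (in group) inv_mult_cancel_left:
  assumes "x \<in> carrier G" "y \<in> carrier G"
  shows "inv x \<otimes> (x \<otimes> y) = y" "x \<otimes> (inv x \<otimes> y) = y"
  using assms by (simp_all flip: m_assoc)

context G_module
begin

section \<open>Arithmetic of the module action\<close>

lemma act_closed [simp]: "\<lbrakk>g \<in> carrier G; a \<in> carrier A\<rbrakk> \<Longrightarrow> act g a \<in> carrier A"
  by (rule element_image) auto

lemma act_mult:
  "\<lbrakk>g \<in> carrier G; h \<in> carrier G; a \<in> carrier A\<rbrakk> \<Longrightarrow> act (g \<otimes> h) a = act g (act h a)"
  by (simp add: composition_rule)

lemma act_one [simp]: "a \<in> carrier A \<Longrightarrow> act \<one> a = a"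
  by (simp flip: id_eq_one)

lemma act_cancel [simp]:
  assumes "g \<in> carrier G" "a \<in> carrier A"
  shows "act g (act (inv g) a) = a" "act (inv g) (act g a) = a"
  using assms by (simp_all flip: act_mult)

lemma act_zero [simp]:
  assumes "g \<in> carrier G" shows "act g \<zero>\<^bsub>A\<^esub> = \<zero>\<^bsub>A\<^esub>"
proof -
  have "act g \<zero>\<^bsub>A\<^esub> \<oplus>\<^bsub>A\<^esub> act g \<zero>\<^bsub>A\<^esub> = act g \<zero>\<^bsub>A\<^esub> \<oplus>\<^bsub>A\<^esub> \<zero>\<^bsub>A\<^esub>"
    using assms by (simp flip: act_add)
  then show ?thesis
    using assms by (simp only: add.l_cancel act_closed zero_closed)
qed

lemma act_minus:
  assumes "g \<in> carrier G" "a \<in> carrier A" shows "act g (\<ominus>\<^bsub>A\<^esub> a) = \<ominus>\<^bsub>A\<^esub> act g a"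
proof -
  have "act g (\<ominus>\<^bsub>A\<^esub> a) \<oplus>\<^bsub>A\<^esub> act g a = \<zero>\<^bsub>A\<^esub>"
    using assms by (simp add: l_neg flip: act_add)
  then show ?thesis
    using assms by (simp add: minus_equality)
qed

lemma minus_zero [simp]: "\<ominus>\<^bsub>A\<^esub> \<zero>\<^bsub>A\<^esub> = \<zero>\<^bsub>A\<^esub>"
  by (rule minus_equality) simp_all

lemmas act_simps = act_mult act_add act_minus
lemmas G_simps = m_assoc inv_mult_group inv_mult_cancel_left

section \<open>Cochains and coboundaries in low degree\<close>

lemma cochain_closed:
  assumes "\<sigma> \<in> carrier (cochains n)" "set xs \<subseteq> carrier G" "length xs = n"
  shows "\<sigma> xs \<in> carrier A"
  using assms by (auto simp: cochains_def tuples_def)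

lemma cochains_eqI:
  assumes "\<sigma> \<in> carrier (cochains n)" "\<tau> \<in> carrier (cochains n)"
    and "\<And>xs. xs \<in> tuples n \<Longrightarrow> \<sigma> xs = \<tau> xs"
  shows "\<sigma> = \<tau>"
  using assms unfolding cochains_def by (auto intro: PiE_ext)

lemma tuples_3:
  "xs \<in> tuples 3 \<longleftrightarrow> (\<exists>x\<in>carrier G. \<exists>y\<in>carrier G. \<exists>z\<in>carrier G. xs = [x, y, z])"
  by (auto simp: tuples_def length_Suc_conv numeral_3_eq_3)

lemma coboundary_2:
  assumes "\<sigma> \<in> carrier (cochains 2)" "x \<in> carrier G" "y \<in> carrier G" "z \<in> carrier G"
  shows "coboundary 2 \<sigma> [x, y, z] =
    act x (\<sigma> [y, z]) \<oplus>\<^bsub>A\<^esub> (\<ominus>\<^bsub>A\<^esub> \<sigma> [x \<otimes> y, z] \<oplus>\<^bsub>A\<^esub> \<sigma> [x, y \<otimes> z]) \<oplus>\<^bsub>A\<^esub> \<ominus>\<^bsub>A\<^esub> \<sigma> [x, y]"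
proof -
  have "{1..2::nat} = {1, 2}" by auto
  then show ?thesis
    using assms
    by (simp add: coboundary_def tuples_def merge_def alternate_def cochain_closed)
qed

lemma coboundary_3:
  assumes "\<alpha> \<in> carrier (cochains 3)"
    and "x \<in> carrier G" "y \<in> carrier G" "z \<in> carrier G" "w \<in> carrier G"
  shows "coboundary 3 \<alpha> [x, y, z, w] =
    act x (\<alpha> [y, z, w]) \<oplus>\<^bsub>A\<^esub> (\<ominus>\<^bsub>A\<^esub> \<alpha> [x \<otimes> y, z, w] \<oplus>\<^bsub>A\<^esub> (\<alpha> [x, y \<otimes> z, w]
      \<oplus>\<^bsub>A\<^esub> \<ominus>\<^bsub>A\<^esub> \<alpha> [x, y, z \<otimes> w])) \<oplus>\<^bsub>A\<^esub> \<alpha> [x, y, z]"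
proof -
  have "{1..3::nat} = {1, 2, 3}" by auto
  then show ?thesis
    using assms
    by (simp add: coboundary_def tuples_def merge_def alternate_def cochain_closed)
qed

lemma coboundary_2_closed:
  assumes "\<sigma> \<in> carrier (cochains 2)" shows "coboundary 2 \<sigma> \<in> carrier (cochains 3)"
proof -
  have "coboundary 2 \<sigma> xs \<in> carrier A" if "xs \<in> tuples 3" for xs
    using that assms by (auto simp: tuples_3 coboundary_2 cochain_closed)
  moreover have "coboundary 2 \<sigma> \<in> extensional (tuples 3)"
    by (simp add: coboundary_def)
  ultimately show ?thesis
    by (auto simp: cochains_def PiE_def)
qed

section \<open>Symmetric 3-cocycles\<close>

lemma ZS3_D:
  assumes "\<alpha> \<in> carrier ZS3"
  shows "\<alpha> \<in> carrier (cochains 3)"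
    and "\<lbrakk>x \<in> carrier G; y \<in> carrier G; z \<in> carrier G\<rbrakk>
      \<Longrightarrow> \<alpha> [x, y, z] = \<ominus>\<^bsub>A\<^esub> act x (\<alpha> [inv x, x \<otimes> y, z])"
    and "\<lbrakk>x \<in> carrier G; y \<in> carrier G; z \<in> carrier G\<rbrakk>
      \<Longrightarrow> \<alpha> [x, y, z] = \<ominus>\<^bsub>A\<^esub> \<alpha> [x \<otimes> y, inv y, y \<otimes> z]"
    and "\<lbrakk>x \<in> carrier G; y \<in> carrier G; z \<in> carrier G\<rbrakk>
      \<Longrightarrow> \<alpha> [x, y, z] = \<ominus>\<^bsub>A\<^esub> \<alpha> [x, y \<otimes> z, inv z]"
proof -
  have "\<alpha> \<in> CS3"
    using assms by (simp add: ZS3_def)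
  then show "\<alpha> \<in> carrier (cochains 3)"
    and "\<lbrakk>x \<in> carrier G; y \<in> carrier G; z \<in> carrier G\<rbrakk>
      \<Longrightarrow> \<alpha> [x, y, z] = \<ominus>\<^bsub>A\<^esub> act x (\<alpha> [inv x, x \<otimes> y, z])"
    and "\<lbrakk>x \<in> carrier G; y \<in> carrier G; z \<in> carrier G\<rbrakk>
      \<Longrightarrow> \<alpha> [x, y, z] = \<ominus>\<^bsub>A\<^esub> \<alpha> [x \<otimes> y, inv y, y \<otimes> z]"
    and "\<lbrakk>x \<in> carrier G; y \<in> carrier G; z \<in> carrier G\<rbrakk>
      \<Longrightarrow> \<alpha> [x, y, z] = \<ominus>\<^bsub>A\<^esub> \<alpha> [x, y \<otimes> z, inv z]"
    unfolding CS3_def by blast+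
qed

lemma ZS3_closed:
  "\<lbrakk>\<alpha> \<in> carrier ZS3; x \<in> carrier G; y \<in> carrier G; z \<in> carrier G\<rbrakk> \<Longrightarrow> \<alpha> [x, y, z] \<in> carrier A"
  by (simp add: cochain_closed[OF ZS3_D(1)])

text \<open>The negative terms of the coboundary are moved to the left, so that the two sides carry
  as many values of \<alpha> as the two sides of \<open>m_assoc4\<close>: two and three.\<close>

lemma ZS3_cocycle:
  assumes "\<alpha> \<in> carrier ZS3"
    and "x \<in> carrier G" "y \<in> carrier G" "z \<in> carrier G" "w \<in> carrier G"
  shows "\<alpha> [x, y, z \<otimes> w] \<oplus>\<^bsub>A\<^esub> \<alpha> [x \<otimes> y, z, w] =
    act x (\<alpha> [y, z, w]) \<oplus>\<^bsub>A\<^esub> \<alpha> [x, y \<otimes> z, w] \<oplus>\<^bsub>A\<^esub> \<alpha> [x, y, z]" (is "?p \<oplus>\<^bsub>A\<^esub> ?q = ?r")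
proof -
  have "coboundary 3 \<alpha> [x, y, z, w] = \<zero>\<^bsub>A\<^esub>"
    using assms by (simp add: ZS3_def cochains_def tuples_def)
  then have "?r \<oplus>\<^bsub>A\<^esub> \<ominus>\<^bsub>A\<^esub> (?p \<oplus>\<^bsub>A\<^esub> ?q) = \<zero>\<^bsub>A\<^esub>"
    using assms by (simp add: coboundary_3 ZS3_D(1) ZS3_closed minus_add a_ac)
  then have "?r = ?p \<oplus>\<^bsub>A\<^esub> ?q"
    using assms minus_equality[of ?r "\<ominus>\<^bsub>A\<^esub> (?p \<oplus>\<^bsub>A\<^esub> ?q)"] by (simp add: ZS3_closed)
  then show ?thesis ..
qed

text \<open>Think of \<open>\<alpha> [x, y, z]\<close> as the value on the simplex \<open>(1, x, xy, xyz)\<close> of an equivariant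
  alternating function; then \<open>act g (\<alpha> [g\<^sup>-\<^sup>1h, h\<^sup>-\<^sup>1k, k\<^sup>-\<^sup>1])\<close> is its value on \<open>(g, h, k, 1)\<close>, and the
  next lemmas are permutations of the vertices.\<close>

lemma ZS3_rotate:
  assumes "\<alpha> \<in> carrier ZS3" "g \<in> carrier G" "h \<in> carrier G" "k \<in> carrier G"
  shows "act g (\<alpha> [inv g \<otimes> h, inv h \<otimes> k, inv k]) = \<alpha> [h, inv h \<otimes> g, inv g \<otimes> k]"
proof -
  note closed = ZS3_closed[OF assms(1)]
  \<comment> \<open>The defining symmetries only swap adjacent vertices, so the 3-cycle is walked as
    (1,h,g,k), (1,g,h,k), (g,1,h,k), (g,h,1,k), (g,h,k,1); four signs cancel.\<close>
  have "\<alpha> [h, inv h \<otimes> g, inv g \<otimes> k] = \<ominus>\<^bsub>A\<^esub> \<alpha> [g, inv g \<otimes> h, inv h \<otimes> k]"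
    using assms by (subst ZS3_D(3)) (simp_all add: G_simps)
  also have "\<alpha> [g, inv g \<otimes> h, inv h \<otimes> k] = \<ominus>\<^bsub>A\<^esub> act g (\<alpha> [inv g, h, inv h \<otimes> k])"
    using assms by (subst ZS3_D(2)) (simp_all add: G_simps)
  also have "\<alpha> [inv g, h, inv h \<otimes> k] = \<ominus>\<^bsub>A\<^esub> \<alpha> [inv g \<otimes> h, inv h, k]"
    using assms by (subst ZS3_D(3)) (simp_all add: G_simps)
  also have "\<alpha> [inv g \<otimes> h, inv h, k] = \<ominus>\<^bsub>A\<^esub> \<alpha> [inv g \<otimes> h, inv h \<otimes> k, inv k]"
    using assms by (subst ZS3_D(4)) (simp_all add: G_simps)
  finally show ?thesis
    using assms by (simp add: closed act_minus)
qed

lemma ZS3_reflect: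
  assumes "\<alpha> \<in> carrier ZS3" "g \<in> carrier G" "h \<in> carrier G" "k \<in> carrier G"
  shows "\<ominus>\<^bsub>A\<^esub> act g (\<alpha> [inv g \<otimes> h, inv h \<otimes> k, inv k]) = \<alpha> [h, inv h \<otimes> k, inv k \<otimes> g]"
proof -
  have "\<alpha> [h, inv h \<otimes> k, inv k \<otimes> g] = \<ominus>\<^bsub>A\<^esub> \<alpha> [h, inv h \<otimes> g, inv g \<otimes> k]"
    using assms by (subst ZS3_D(4)) (simp_all add: G_simps)
  then show ?thesis
    using assms by (simp add: ZS3_rotate)
qed

lemma ZS3_cycle:
  assumes "\<alpha> \<in> carrier ZS3" "x \<in> carrier G" "y \<in> carrier G" "z \<in> carrier G"
  shows "\<alpha> [x \<otimes> y, z, inv z \<otimes> inv y] = \<alpha> [x, y, z]"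
proof -
  note closed = ZS3_closed[OF assms(1)]
  \<comment> \<open>The vertex orders along the chain are (1,x,xy,xyz), (1,x,xyz,xy), (1,xyz,x,xy),
    (1,xyz,xy,x), (1,xy,xyz,x).\<close>
  have "\<alpha> [x, y, z] = \<ominus>\<^bsub>A\<^esub> \<alpha> [x, y \<otimes> z, inv z]"
    using assms by (subst ZS3_D(4)) (simp_all add: G_simps)
  also have "\<alpha> [x, y \<otimes> z, inv z] = \<ominus>\<^bsub>A\<^esub> \<alpha> [x \<otimes> y \<otimes> z, inv z \<otimes> inv y, y]"
    using assms by (subst ZS3_D(3)) (simp_all add: G_simps)
  also have "\<alpha> [x \<otimes> y \<otimes> z, inv z \<otimes> inv y, y] = \<ominus>\<^bsub>A\<^esub> \<alpha> [x \<otimes> y \<otimes> z, inv z, inv y]"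
    using assms by (subst ZS3_D(4)) (simp_all add: G_simps)
  also have "\<alpha> [x \<otimes> y \<otimes> z, inv z, inv y] = \<ominus>\<^bsub>A\<^esub> \<alpha> [x \<otimes> y, z, inv z \<otimes> inv y]"
    using assms by (subst ZS3_D(3)) (simp_all add: G_simps)
  finally show ?thesis
    using assms by (simp add: closed)
qed

section \<open>The \<Delta>-group axioms for T(G,A,\<alpha>)\<close>

lemma T_alpha_T: "\<T> (T_alpha \<alpha>) g h = (\<lambda>a. (a, (g, h))) ` carrier A"
  by (auto simp: T_alpha_def)

lemma T_alpha_ops:
  "\<m> (T_alpha \<alpha>) g h k (a, i) (b, i') (c, i'') =
    (a \<oplus>\<^bsub>A\<^esub> act (inv g \<otimes> h) b \<oplus>\<^bsub>A\<^esub> c \<oplus>\<^bsub>A\<^esub> \<alpha> [inv g \<otimes> h, inv h \<otimes> k, inv k], (g, inv k))"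
  "\<P> (T_alpha \<alpha>) g h (a, i) = (act g a, (h, inv g \<otimes> inv h))"
  "\<Q> (T_alpha \<alpha>) g h (a, i) = (\<ominus>\<^bsub>A\<^esub> act g a, (inv g, h \<otimes> g))"
  by (simp_all add: T_alpha_def)

lemmas T_alpha_simps = T_alpha_T T_alpha_ops

text \<open>\<open>delta_group_iso\<close> includes the claim that both sides are \<Delta>-groups.
  The laws in \<open>P\<close> and \<open>Q\<close> alone use only the group action. In the laws for
  m the values of \<alpha> match by a 3-cycle of (g, h, k, 1) for \<open>P_m\<close>, the exchange
  of g and 1 for \<open>Q_m\<close>, the cocycle identity for \<open>m_assoc4\<close>, and the
  exchange of h and k, with its sign, for \<open>m_cancel\<close>.\<close>

lemma delta_group_T_alpha:
  assumes \<alpha>: "\<alpha> \<in> carrier ZS3"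
  shows "delta_group G (T_alpha \<alpha>)"
proof
  note closed = ZS3_closed[OF \<alpha>]
  fix g h k assume G: "g \<in> carrier G" "h \<in> carrier G" "k \<in> carrier G"
  {
    fix x assume "x \<in> \<T> (T_alpha \<alpha>) g h"
    then show "\<P> (T_alpha \<alpha>) g h x \<in> \<T> (T_alpha \<alpha>) h (inv g \<otimes> inv h)"
      and "\<Q> (T_alpha \<alpha>) g h x \<in> \<T> (T_alpha \<alpha>) (inv g) (h \<otimes> g)"
      and "\<P> (T_alpha \<alpha>) (inv g \<otimes> inv h) g (\<P> (T_alpha \<alpha>) h (inv g \<otimes> inv h) (\<P> (T_alpha \<alpha>) g h x)) = x"
      and "\<Q> (T_alpha \<alpha>) (inv g) (h \<otimes> g) (\<Q> (T_alpha \<alpha>) g h x) = x"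
      and "\<P> (T_alpha \<alpha>) (h \<otimes> g) (inv h) (\<P> (T_alpha \<alpha>) (inv g) (h \<otimes> g) (\<Q> (T_alpha \<alpha>) g h x))
        = \<Q> (T_alpha \<alpha>) h (inv g \<otimes> inv h) (\<P> (T_alpha \<alpha>) g h x)"
      using G by (auto simp: T_alpha_simps G_simps act_simps)
  }
  {
    fix a b c assume "a \<in> \<T> (T_alpha \<alpha>) g (inv h)" "b \<in> \<T> (T_alpha \<alpha>) h (inv k)"
      "c \<in> \<T> (T_alpha \<alpha>) (inv h \<otimes> g) (inv k \<otimes> h)"
    then obtain a' b' c' where [simp]: "a = (a', (g, inv h))" "b = (b', (h, inv k))"
      "c = (c', (inv h \<otimes> g, inv k \<otimes> h))" "a' \<in> carrier A" "b' \<in> carrier A" "c' \<in> carrier A"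
      by (auto simp: T_alpha_T)
    let ?\<alpha> = "\<alpha> [inv g \<otimes> h, inv h \<otimes> k, inv k]"
    show "\<m> (T_alpha \<alpha>) g h k a b c \<in> \<T> (T_alpha \<alpha>) g (inv k)"
      using G by (simp add: T_alpha_simps closed)
    show "\<P> (T_alpha \<alpha>) g (inv k) (\<m> (T_alpha \<alpha>) g h k a b c) =
          \<m> (T_alpha \<alpha>) (inv k) (inv k \<otimes> h) (inv k \<otimes> g)
            (\<P> (T_alpha \<alpha>) h (inv k) b) (\<P> (T_alpha \<alpha>) (inv h \<otimes> g) (inv k \<otimes> h) c)
            (\<P> (T_alpha \<alpha>) g (inv h) a)"
      using G ZS3_rotate[OF \<alpha> G]
      by (simp add: T_alpha_ops closed G_simps act_simps a_ac)
    show "\<Q> (T_alpha \<alpha>) g (inv k) (\<m> (T_alpha \<alpha>) g h k a b c) =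
          \<m> (T_alpha \<alpha>) (inv g) (inv g \<otimes> h) (inv g \<otimes> k)
            (\<Q> (T_alpha \<alpha>) g (inv h) a) (\<Q> (T_alpha \<alpha>) (inv h \<otimes> g) (inv k \<otimes> h) c)
            (\<Q> (T_alpha \<alpha>) h (inv k) b)"
      using G ZS3_reflect[OF \<alpha> G]
      by (simp add: T_alpha_ops closed G_simps act_simps a_ac minus_add)
    {
      fix l d e f assume l: "l \<in> carrier G" and "d \<in> \<T> (T_alpha \<alpha>) k (inv l)"
        "e \<in> \<T> (T_alpha \<alpha>) (inv k \<otimes> g) (inv l \<otimes> k)" "f \<in> \<T> (T_alpha \<alpha>) (inv k \<otimes> h) (inv l \<otimes> k)"
      then obtain d' e' f' where [simp]: "d = (d', (k, inv l))"
        "e = (e', (inv k \<otimes> g, inv l \<otimes> k))" "f = (f', (inv k \<otimes> h, inv l \<otimes> k))"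
        "d' \<in> carrier A" "e' \<in> carrier A" "f' \<in> carrier A"
        by (auto simp: T_alpha_T)
      \<comment> \<open>The five values belong to the faces of (g, h, k, l, 1), translated by g^-1.
        The inner m with \<open>c\<close> and \<open>e\<close> lists one face as (g, k, l, h), while
        the coboundary has (g, h, k, l); \<open>ZS3_cycle\<close> identifies them.\<close>
      have cocycle: "?\<alpha> \<oplus>\<^bsub>A\<^esub> \<alpha> [inv g \<otimes> k, inv k \<otimes> l, inv l] =
        act (inv g) (act h (\<alpha> [inv h \<otimes> k, inv k \<otimes> l, inv l]))
          \<oplus>\<^bsub>A\<^esub> \<alpha> [inv g \<otimes> h, inv h \<otimes> l, inv l] \<oplus>\<^bsub>A\<^esub> \<alpha> [inv g \<otimes> k, inv k \<otimes> l, inv l \<otimes> h]"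
        using ZS3_cocycle[OF \<alpha>, of "inv g \<otimes> h" "inv h \<otimes> k" "inv k \<otimes> l" "inv l"]
          ZS3_cycle[OF \<alpha>, of "inv g \<otimes> h" "inv h \<otimes> k" "inv k \<otimes> l"] G l
        by (simp add: G_simps act_simps closed)
      show "\<m> (T_alpha \<alpha>) g k l (\<m> (T_alpha \<alpha>) g h k a b c) d e =
          \<m> (T_alpha \<alpha>) g h l a (\<m> (T_alpha \<alpha>) h k l b d f)
            (\<m> (T_alpha \<alpha>) (inv h \<otimes> g) (inv h \<otimes> k) (inv h \<otimes> l) c
              (\<Q> (T_alpha \<alpha>) (inv k \<otimes> h) (inv l \<otimes> k) f) e)"
      proof -
        let ?u = "a' \<oplus>\<^bsub>A\<^esub> act (inv g) (act h b') \<oplus>\<^bsub>A\<^esub> c' \<oplus>\<^bsub>A\<^esub> act (inv g) (act k d') \<oplus>\<^bsub>A\<^esub> e'"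
        let ?f = "act (inv g) (act h f')"
        have "\<m> (T_alpha \<alpha>) g k l (\<m> (T_alpha \<alpha>) g h k a b c) d e =
          (?u \<oplus>\<^bsub>A\<^esub> (?\<alpha> \<oplus>\<^bsub>A\<^esub> \<alpha> [inv g \<otimes> k, inv k \<otimes> l, inv l]), (g, inv l))"
          using G l by (simp add: T_alpha_ops closed G_simps act_simps a_ac)
        \<comment> \<open>On the right \<open>f\<close> enters twice, directly and through
          \<open>Q\<close>, contributing \<open>?f\<close> and its negative; on the left it does not
          occur. Inserting the pair gives both sides the same summands.\<close>
        also have "\<dots> = (?u \<oplus>\<^bsub>A\<^esub> (?f \<oplus>\<^bsub>A\<^esub> \<ominus>\<^bsub>A\<^esub> ?f) \<oplus>\<^bsub>A\<^esub> (?\<alpha> \<oplus>\<^bsub>A\<^esub> \<alpha> [inv g \<otimes> k, inv k \<otimes> l, inv l]), (g, inv l))"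
          using G l by (simp add: r_neg closed)
        also have "\<dots> = \<m> (T_alpha \<alpha>) g h l a (\<m> (T_alpha \<alpha>) h k l b d f)
            (\<m> (T_alpha \<alpha>) (inv h \<otimes> g) (inv h \<otimes> k) (inv h \<otimes> l) c
              (\<Q> (T_alpha \<alpha>) (inv k \<otimes> h) (inv l \<otimes> k) f) e)"
          unfolding cocycle using G l by (simp add: T_alpha_ops closed G_simps act_simps a_ac)
        finally show ?thesis .
      qed
    }
  }
  {
    fix f a b assume "f \<in> \<T> (T_alpha \<alpha>) g (inv h)" "a \<in> \<T> (T_alpha \<alpha>) h (inv k)"
      "b \<in> \<T> (T_alpha \<alpha>) (inv h \<otimes> g) (inv k \<otimes> h)"
    then obtain f' a' b' where [simp]: "f = (f', (g, inv h))" "a = (a', (h, inv k))"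
      "b = (b', (inv h \<otimes> g, inv k \<otimes> h))" "f' \<in> carrier A" "a' \<in> carrier A" "b' \<in> carrier A"
      by (auto simp: T_alpha_T)
    have "\<alpha> [inv g \<otimes> h, inv h \<otimes> k, inv k] = \<ominus>\<^bsub>A\<^esub> \<alpha> [inv g \<otimes> k, inv k \<otimes> h, inv h]"
      using \<alpha> G by (subst ZS3_D(3)) (simp_all add: G_simps)
    \<comment> \<open>The cancellation rules act on adjacent summands only, and here
      \<open>f'\<close> stands between \<open>b'\<close> and its negative.\<close>
    moreover have "b' \<oplus>\<^bsub>A\<^esub> (f' \<oplus>\<^bsub>A\<^esub> \<ominus>\<^bsub>A\<^esub> b') = f'"
      by (subst a_lcomm) (simp_all add: r_neg)
    ultimately show "\<m> (T_alpha \<alpha>) g k h (\<m> (T_alpha \<alpha>) g h k f a b)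
            (\<P> (T_alpha \<alpha>) (inv k \<otimes> h) k (\<P> (T_alpha \<alpha>) (inv h) (inv k \<otimes> h) (\<Q> (T_alpha \<alpha>) h (inv k) a)))
            (\<P> (T_alpha \<alpha>) (inv g \<otimes> h) (inv k \<otimes> g) (\<Q> (T_alpha \<alpha>) (inv h \<otimes> g) (inv k \<otimes> h) b)) = f"
      using G by (simp add: T_alpha_ops closed G_simps act_simps a_ac r_neg1 r_neg2 r_neg l_neg)
  }
qed

section \<open>Symmetric 2-cochains and classes in HS3\<close>

lemma CS2_D:
  assumes "\<sigma> \<in> CS2"
  shows "\<sigma> \<in> carrier (cochains 2)"
    and "\<lbrakk>x \<in> carrier G; y \<in> carrier G\<rbrakk> \<Longrightarrow> \<sigma> [x, y] = \<ominus>\<^bsub>A\<^esub> act x (\<sigma> [inv x, x \<otimes> y])"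
    and "\<lbrakk>x \<in> carrier G; y \<in> carrier G\<rbrakk> \<Longrightarrow> \<sigma> [x, y] = \<ominus>\<^bsub>A\<^esub> \<sigma> [x \<otimes> y, inv y]"
  using assms unfolding CS2_def by blast+

lemma zero_in_CS2: "\<one>\<^bsub>cochains 2\<^esub> \<in> CS2"
  by (auto simp: CS2_def cochains_def tuples_def)

lemma add_in_CS2:
  assumes "\<sigma> \<in> CS2" "\<tau> \<in> CS2"
  shows "\<sigma> \<otimes>\<^bsub>cochains 2\<^esub> \<tau> \<in> CS2"
proof -
  note closed = cochain_closed[OF CS2_D(1)[OF assms(1)]] cochain_closed[OF CS2_D(1)[OF assms(2)]]
  have eq: "(\<sigma> \<otimes>\<^bsub>cochains 2\<^esub> \<tau>) [x, y] = \<sigma> [x, y] \<oplus>\<^bsub>A\<^esub> \<tau> [x, y]"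
    if "x \<in> carrier G" "y \<in> carrier G" for x y
    using that by (simp add: cochains_def tuples_def)
  have "(\<sigma> \<otimes>\<^bsub>cochains 2\<^esub> \<tau>) \<in> carrier (cochains 2)"
    using closed by (auto simp: cochains_def tuples_def)
  moreover {
    fix x y assume xy: "x \<in> carrier G" "y \<in> carrier G"
    have "\<sigma> [x, y] \<oplus>\<^bsub>A\<^esub> \<tau> [x, y] =
        \<ominus>\<^bsub>A\<^esub> act x (\<sigma> [inv x, x \<otimes> y] \<oplus>\<^bsub>A\<^esub> \<tau> [inv x, x \<otimes> y])"
      using xy by (subst (1 2) CS2_D(2)) (simp_all add: assms closed act_simps minus_add)
    moreover have "\<sigma> [x, y] \<oplus>\<^bsub>A\<^esub> \<tau> [x, y] =
        \<ominus>\<^bsub>A\<^esub> (\<sigma> [x \<otimes> y, inv y] \<oplus>\<^bsub>A\<^esub> \<tau> [x \<otimes> y, inv y])"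
      using xy by (subst (1 2) CS2_D(3)) (simp_all add: assms closed minus_add)
    ultimately have "(\<sigma> \<otimes>\<^bsub>cochains 2\<^esub> \<tau>) [x, y] = \<ominus>\<^bsub>A\<^esub> act x ((\<sigma> \<otimes>\<^bsub>cochains 2\<^esub> \<tau>) [inv x, x \<otimes> y])
      \<and> (\<sigma> \<otimes>\<^bsub>cochains 2\<^esub> \<tau>) [x, y] = \<ominus>\<^bsub>A\<^esub> (\<sigma> \<otimes>\<^bsub>cochains 2\<^esub> \<tau>) [x \<otimes> y, inv y]"
      using xy by (simp add: eq) }
  ultimately show ?thesis
    unfolding CS2_def by blast
qed

lemma minus_in_CS2:
  assumes "\<sigma> \<in> CS2"
  shows "(\<lambda>xs\<in>tuples 2. \<ominus>\<^bsub>A\<^esub> \<sigma> xs) \<in> CS2" (is "?\<tau> \<in> _")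
proof -
  note closed = cochain_closed[OF CS2_D(1)[OF assms(1)]]
  have "?\<tau> \<in> carrier (cochains 2)"
    using closed by (auto simp: cochains_def tuples_def)
  moreover {
    fix x y assume xy: "x \<in> carrier G" "y \<in> carrier G"
    have "?\<tau> [x, y] = \<ominus>\<^bsub>A\<^esub> act x (?\<tau> [inv x, x \<otimes> y]) \<and> ?\<tau> [x, y] = \<ominus>\<^bsub>A\<^esub> ?\<tau> [x \<otimes> y, inv y]"
      using xy CS2_D(2)[OF assms xy] CS2_D(3)[OF assms xy]
      by (simp add: tuples_def closed act_simps) }
  ultimately show ?thesis
    unfolding CS2_def by blast
qed

text \<open>The cobounding cochain stays an argument because the same \<sigma> later serves as the
  shift of the isomorphism. Zero, sum and negation in \<open>CS2\<close> supply the witnesses for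
  reflexivity, transitivity and symmetry.\<close>

definition cohomologous :: "('g list \<Rightarrow> 'a) \<Rightarrow> ('g list \<Rightarrow> 'a) \<Rightarrow> ('g list \<Rightarrow> 'a) \<Rightarrow> bool"
  where "cohomologous \<sigma> \<alpha> \<beta> \<longleftrightarrow> (\<forall>x\<in>carrier G. \<forall>y\<in>carrier G. \<forall>z\<in>carrier G.
    \<alpha> [x, y, z] = coboundary 2 \<sigma> [x, y, z] \<oplus>\<^bsub>A\<^esub> \<beta> [x, y, z])"

text \<open>\<open>cohomologous\<close> sees only values on triples; membership of \<gamma> in
  \<open>cochains 3\<close> supplies the extensionality that turns agreement there into equality of
  functions.\<close>

lemma mem_HS3_class:
  assumes "\<beta> \<in> carrier (cochains 3)"
  shows "\<gamma> \<in> HS3_class \<beta> \<longleftrightarrow> \<gamma> \<in> carrier (cochains 3) \<and> (\<exists>\<sigma>\<in>CS2. cohomologous \<sigma> \<gamma> \<beta>)"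
proof -
  have mult: "\<delta> \<otimes>\<^bsub>ZS3\<^esub> \<beta> = (\<lambda>xs\<in>tuples 3. \<delta> xs \<oplus>\<^bsub>A\<^esub> \<beta> xs)" for \<delta>
    by (simp add: ZS3_def cochains_def)
  have "\<gamma> = coboundary 2 \<sigma> \<otimes>\<^bsub>ZS3\<^esub> \<beta> \<longleftrightarrow> \<gamma> \<in> carrier (cochains 3) \<and> cohomologous \<sigma> \<gamma> \<beta>"
    if "\<sigma> \<in> CS2" for \<sigma>
  proof -
    have closed: "coboundary 2 \<sigma> \<otimes>\<^bsub>ZS3\<^esub> \<beta> \<in> carrier (cochains 3)"
      using coboundary_2_closed[OF CS2_D(1)[OF that]] assms
      by (auto simp: mult cochains_def)
    show ?thesis
    proof (intro iffI conjI)
      assume "\<gamma> \<in> carrier (cochains 3) \<and> cohomologous \<sigma> \<gamma> \<beta>"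
      then show "\<gamma> = coboundary 2 \<sigma> \<otimes>\<^bsub>ZS3\<^esub> \<beta>"
        by (intro cochains_eqI[OF _ closed]) (auto simp: mult cohomologous_def tuples_3)
    qed (use closed in \<open>auto simp: mult cohomologous_def tuples_3\<close>)
  qed
  then show ?thesis
    by (auto simp: HS3_class_def BS3_def r_coset_def)
qed

lemma cohomologous_refl:
  assumes "\<beta> \<in> carrier (cochains 3)"
  shows "cohomologous \<one>\<^bsub>cochains 2\<^esub> \<beta> \<beta>"
proof -
  have "\<one>\<^bsub>cochains 2\<^esub> [x, y] = \<zero>\<^bsub>A\<^esub>" if "x \<in> carrier G" "y \<in> carrier G" for x y
    using that by (simp add: cochains_def tuples_def)
  then show ?thesis
    using assms zero_in_CS2
    by (simp add: cohomologous_def coboundary_2 CS2_D(1) cochain_closed)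
qed

lemma cohomologous_trans:
  assumes "\<sigma> \<in> CS2" "\<tau> \<in> CS2" "\<gamma> \<in> carrier (cochains 3)"
    and "cohomologous \<sigma> \<alpha> \<beta>" "cohomologous \<tau> \<beta> \<gamma>"
  shows "cohomologous (\<sigma> \<otimes>\<^bsub>cochains 2\<^esub> \<tau>) \<alpha> \<gamma>"
proof -
  have eq: "(\<sigma> \<otimes>\<^bsub>cochains 2\<^esub> \<tau>) [x, y] = \<sigma> [x, y] \<oplus>\<^bsub>A\<^esub> \<tau> [x, y]"
    if "x \<in> carrier G" "y \<in> carrier G" for x y
    using that by (simp add: cochains_def tuples_def)
  note closed = cochain_closed[OF CS2_D(1)[OF assms(1)]] cochain_closed[OF CS2_D(1)[OF assms(2)]]
    cochain_closed[OF assms(3)]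
  show ?thesis
    using assms CS2_D(1)[OF add_in_CS2[OF assms(1,2)]]
    by (simp add: cohomologous_def coboundary_2 CS2_D(1) closed eq act_simps minus_add a_ac)
qed

lemma cohomologous_sym:
  assumes "\<sigma> \<in> CS2" "\<beta> \<in> carrier (cochains 3)" and "cohomologous \<sigma> \<alpha> \<beta>"
  shows "cohomologous (\<lambda>xs\<in>tuples 2. \<ominus>\<^bsub>A\<^esub> \<sigma> xs) \<beta> \<alpha>"
  unfolding cohomologous_def
proof (intro ballI)
  fix x y z assume G: "x \<in> carrier G" "y \<in> carrier G" "z \<in> carrier G"
  have closed: "coboundary 2 \<sigma> [x, y, z] \<in> carrier A" "\<beta> [x, y, z] \<in> carrier A"
    using G cochain_closed[OF coboundary_2_closed[OF CS2_D(1)[OF assms(1)]]] cochain_closed[OF assms(2)]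
    by simp_all
  have "coboundary 2 (\<lambda>xs\<in>tuples 2. \<ominus>\<^bsub>A\<^esub> \<sigma> xs) [x, y, z] = \<ominus>\<^bsub>A\<^esub> coboundary 2 \<sigma> [x, y, z]"
    using assms(1) CS2_D(1)[OF minus_in_CS2[OF assms(1)]] G
    by (simp add: coboundary_2 CS2_D(1) cochain_closed[OF CS2_D(1)] tuples_def act_simps minus_add)
  then show "\<beta> [x, y, z] = coboundary 2 (\<lambda>xs\<in>tuples 2. \<ominus>\<^bsub>A\<^esub> \<sigma> xs) [x, y, z] \<oplus>\<^bsub>A\<^esub> \<alpha> [x, y, z]"
    using assms(3) G closed by (simp add: cohomologous_def r_neg1)
qed

text \<open>By \<open>mem_HS3_class\<close> a class is everything related to its representative, and
  relatedness by a member of \<open>CS2\<close> is an equivalence relation on 3-cochains.\<close>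

lemma HS3_class_eq_iff:
  assumes \<alpha>: "\<alpha> \<in> carrier (cochains 3)" and \<beta>: "\<beta> \<in> carrier (cochains 3)"
  shows "HS3_class \<alpha> = HS3_class \<beta> \<longleftrightarrow> (\<exists>\<sigma>\<in>CS2. cohomologous \<sigma> \<alpha> \<beta>)"
proof
  assume "HS3_class \<alpha> = HS3_class \<beta>"
  moreover have "\<alpha> \<in> HS3_class \<alpha>"
    using \<alpha> zero_in_CS2 cohomologous_refl by (auto simp: mem_HS3_class)
  ultimately show "\<exists>\<sigma>\<in>CS2. cohomologous \<sigma> \<alpha> \<beta>"
    using \<beta> by (simp add: mem_HS3_class)
next
  assume "\<exists>\<sigma>\<in>CS2. cohomologous \<sigma> \<alpha> \<beta>"
  then obtain \<sigma> \<tau> where "\<sigma> \<in> CS2" "cohomologous \<sigma> \<alpha> \<beta>" "\<tau> \<in> CS2" "cohomologous \<tau> \<beta> \<alpha>"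
    using \<beta> minus_in_CS2 cohomologous_sym by metis
  then show "HS3_class \<alpha> = HS3_class \<beta>"
    using cohomologous_trans[OF _ _ \<alpha>] cohomologous_trans[OF _ _ \<beta>] add_in_CS2
    by (auto simp: mem_HS3_class[OF \<alpha>] mem_HS3_class[OF \<beta>]; blast)
qed

section \<open>Alternation of \<sigma> and compatibility with the operations\<close>

lemma CS2_rotate:
  assumes "\<sigma> \<in> CS2" "g \<in> carrier G" "h \<in> carrier G"
  shows "act g (\<sigma> [inv g \<otimes> inv h, h]) = \<sigma> [g, inv g \<otimes> inv h]"
proof -
  note closed = cochain_closed[OF CS2_D(1)[OF assms(1)]]
  have "\<sigma> [g, inv g \<otimes> inv h] = \<ominus>\<^bsub>A\<^esub> act g (\<sigma> [inv g, inv h])"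
    using assms by (subst CS2_D(2)) (simp_all add: G_simps)
  also have "\<sigma> [inv g, inv h] = \<ominus>\<^bsub>A\<^esub> \<sigma> [inv g \<otimes> inv h, h]"
    using assms by (subst CS2_D(3)) (simp_all add: G_simps)
  finally show ?thesis
    using assms by (simp add: closed act_minus)
qed

text \<open>Both left sides, here and in \<open>CS2_rotate\<close>, carry the value \<phi>(g, h^-1,
  1). The right side there is \<phi>(1, g, h^-1), a 3-cycle coming from \<open>P\<close>; here it is
  \<phi>(1, h^-1, g), a transposition coming from \<open>Q\<close>.\<close>

lemma CS2_reflect:
  assumes "\<sigma> \<in> CS2" "g \<in> carrier G" "h \<in> carrier G"
  shows "\<ominus>\<^bsub>A\<^esub> act g (\<sigma> [inv g \<otimes> inv h, h]) = \<sigma> [inv h, h \<otimes> g]"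
proof -
  have "\<sigma> [inv h, h \<otimes> g] = \<ominus>\<^bsub>A\<^esub> \<sigma> [g, inv g \<otimes> inv h]"
    using assms by (subst CS2_D(3)) (simp_all add: G_simps)
  then show ?thesis
    using assms by (simp add: CS2_rotate)
qed

text \<open>A 3-cycle and a transposition generate all permutations of three vertices, so they yield
  the two adjacent swaps that define \<open>CS2\<close>.\<close>

lemma CS2_I:
  assumes \<sigma>: "\<sigma> \<in> carrier (cochains 2)"
    and rotate: "\<And>g h. \<lbrakk>g \<in> carrier G; h \<in> carrier G\<rbrakk>
      \<Longrightarrow> act g (\<sigma> [inv g \<otimes> inv h, h]) = \<sigma> [g, inv g \<otimes> inv h]"
    and reflect: "\<And>g h. \<lbrakk>g \<in> carrier G; h \<in> carrier G\<rbrakk>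
      \<Longrightarrow> \<ominus>\<^bsub>A\<^esub> act g (\<sigma> [inv g \<otimes> inv h, h]) = \<sigma> [inv h, h \<otimes> g]"
  shows "\<sigma> \<in> CS2"
proof -
  have "\<sigma> [x, y] = \<ominus>\<^bsub>A\<^esub> act x (\<sigma> [inv x, x \<otimes> y]) \<and> \<sigma> [x, y] = \<ominus>\<^bsub>A\<^esub> \<sigma> [x \<otimes> y, inv y]"
    if xy: "x \<in> carrier G" "y \<in> carrier G" for x y
  proof -
    \<comment> \<open>With this choice of h the triple (g, h^-1, 1) is (x, xy, 1), a rotation of (1,
      x, xy).\<close>
    have "\<sigma> [x \<otimes> y, inv y] = \<ominus>\<^bsub>A\<^esub> act x (\<sigma> [y, inv y \<otimes> inv x])"
      using reflect[of x "inv y \<otimes> inv x"] xy by (simp add: G_simps)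
    moreover have "\<sigma> [x, y] = act x (\<sigma> [y, inv y \<otimes> inv x])"
      using rotate[of x "inv y \<otimes> inv x"] xy by (simp add: G_simps)
    moreover have "act x (\<sigma> [inv x, x \<otimes> y]) = \<sigma> [x \<otimes> y, inv y]"
      using rotate[of "inv x" "inv y", symmetric] xy
      by (simp add: G_simps cochain_closed[OF \<sigma>])
    ultimately show ?thesis
      using xy by (simp add: cochain_closed[OF \<sigma>])
  qed
  then show ?thesis
    using \<sigma> unfolding CS2_def by blast
qed

text \<open>The third summand \<open>\<sigma> [inv g \<otimes> k, inv k \<otimes> h]\<close>, the shift on \<open>T(h\<^sup>-\<^sup>1g,k\<^sup>-\<^sup>1h)\<close>, is
  \<open>- \<sigma> [inv g \<otimes> h, inv h \<otimes> k]\<close> by alternation, and so completes the coboundary.\<close>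

lemma cohomologous_iff_commutes_m:
  assumes \<sigma>: "\<sigma> \<in> CS2" and \<alpha>: "\<alpha> \<in> carrier (cochains 3)" and \<beta>: "\<beta> \<in> carrier (cochains 3)"
  shows "cohomologous \<sigma> \<alpha> \<beta> \<longleftrightarrow> (\<forall>g\<in>carrier G. \<forall>h\<in>carrier G. \<forall>k\<in>carrier G.
    \<alpha> [inv g \<otimes> h, inv h \<otimes> k, inv k] \<oplus>\<^bsub>A\<^esub> \<sigma> [inv g \<otimes> k, inv k] =
      \<sigma> [inv g \<otimes> h, inv h] \<oplus>\<^bsub>A\<^esub> act (inv g \<otimes> h) (\<sigma> [inv h \<otimes> k, inv k])
        \<oplus>\<^bsub>A\<^esub> \<sigma> [inv g \<otimes> k, inv k \<otimes> h] \<oplus>\<^bsub>A\<^esub> \<beta> [inv g \<otimes> h, inv h \<otimes> k, inv k])"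
    (is "_ \<longleftrightarrow> (\<forall>g\<in>_. \<forall>h\<in>_. \<forall>k\<in>_. ?R g h k)")
proof -
  note closed = cochain_closed[OF CS2_D(1)[OF \<sigma>]] cochain_closed[OF \<alpha>] cochain_closed[OF \<beta>]
  have eq: "\<alpha> [inv g \<otimes> h, inv h \<otimes> k, inv k] = coboundary 2 \<sigma> [inv g \<otimes> h, inv h \<otimes> k, inv k]
      \<oplus>\<^bsub>A\<^esub> \<beta> [inv g \<otimes> h, inv h \<otimes> k, inv k] \<longleftrightarrow> ?R g h k"
    if G: "g \<in> carrier G" "h \<in> carrier G" "k \<in> carrier G" for g h k
  proof -
    let ?s = "\<sigma> [inv g \<otimes> k, inv k]"
    have "\<sigma> [inv g \<otimes> h, inv h \<otimes> k] = \<ominus>\<^bsub>A\<^esub> \<sigma> [inv g \<otimes> k, inv k \<otimes> h]"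
      using \<sigma> G by (subst CS2_D(3)) (simp_all add: G_simps)
    then have sum: "coboundary 2 \<sigma> [inv g \<otimes> h, inv h \<otimes> k, inv k]
        \<oplus>\<^bsub>A\<^esub> \<beta> [inv g \<otimes> h, inv h \<otimes> k, inv k] \<oplus>\<^bsub>A\<^esub> ?s =
      \<sigma> [inv g \<otimes> h, inv h] \<oplus>\<^bsub>A\<^esub> act (inv g \<otimes> h) (\<sigma> [inv h \<otimes> k, inv k])
        \<oplus>\<^bsub>A\<^esub> \<sigma> [inv g \<otimes> k, inv k \<otimes> h] \<oplus>\<^bsub>A\<^esub> \<beta> [inv g \<otimes> h, inv h \<otimes> k, inv k]"
      using G CS2_D(1)[OF \<sigma>]
      by (simp add: coboundary_2 closed G_simps act_simps a_ac r_neg r_neg1 r_neg2 l_neg)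
    \<comment> \<open>\<open>?R\<close> is the equation for \<alpha> with \<open>?s\<close>, the
      shift on the target fibre of m, added to both sides; cancelling \<open>?s\<close> reverses
      this.\<close>
    show ?thesis
      unfolding sum[symmetric] using G
      by (simp add: closed cochain_closed[OF coboundary_2_closed[OF CS2_D(1)[OF \<sigma>]]])
  qed
  show ?thesis
  proof
    assume "cohomologous \<sigma> \<alpha> \<beta>"
    then show "\<forall>g\<in>carrier G. \<forall>h\<in>carrier G. \<forall>k\<in>carrier G. ?R g h k"
      using eq unfolding cohomologous_def by simp
  next
    assume R: "\<forall>g\<in>carrier G. \<forall>h\<in>carrier G. \<forall>k\<in>carrier G. ?R g h k"
    show "cohomologous \<sigma> \<alpha> \<beta>"
      unfolding cohomologous_def
    proof (intro ballI)
      fix x y z assume G: "x \<in> carrier G" "y \<in> carrier G" "z \<in> carrier G"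
      \<comment> \<open>These indices solve g^-1 h = x, h^-1 k = y, k^-1 = z, starting from the last
        equation; hence every triple is reached.\<close>
      have "?R (inv z \<otimes> inv y \<otimes> inv x) (inv z \<otimes> inv y) (inv z)"
        using R G by blast
      then show "\<alpha> [x, y, z] = coboundary 2 \<sigma> [x, y, z] \<oplus>\<^bsub>A\<^esub> \<beta> [x, y, z]"
        using G by (subst (asm) eq[symmetric]) (simp_all add: G_simps)
    qed
  qed
qed

section \<open>Isomorphisms and cobounding cochains\<close>

lemma delta_group_iso_translation:
  assumes \<alpha>: "\<alpha> \<in> carrier ZS3" and \<beta>: "\<beta> \<in> carrier ZS3"
    and \<sigma>: "\<sigma> \<in> CS2" and coh: "cohomologous \<sigma> \<alpha> \<beta>"
  shows "delta_group_iso G (T_alpha \<alpha>) (T_alpha \<beta>)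
    (\<lambda>g h (a, i). (a \<oplus>\<^bsub>A\<^esub> \<sigma> [inv g \<otimes> inv h, h], (g, h)))"
proof (intro delta_group_iso.intro delta_group_iso_axioms.intro delta_group_T_alpha \<alpha> \<beta>)
  note closed = ZS3_closed[OF \<alpha>] ZS3_closed[OF \<beta>] cochain_closed[OF CS2_D(1)[OF \<sigma>]]
  let ?f = "\<lambda>g h (a, i). (a \<oplus>\<^bsub>A\<^esub> \<sigma> [inv g \<otimes> inv h, h], (g, h))"
  fix g h assume G: "g \<in> carrier G" "h \<in> carrier G"
  show "bij_betw (?f g h) (\<T> (T_alpha \<alpha>) g h) (\<T> (T_alpha \<beta>) g h)"
    using G
    by (intro bij_betw_byWitness[where f' = "\<lambda>(a, i). (a \<oplus>\<^bsub>A\<^esub> \<ominus>\<^bsub>A\<^esub> \<sigma> [inv g \<otimes> inv h, h], (g, h))"])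
      (auto simp: T_alpha_T closed a_assoc r_neg l_neg)
  {
    fix x assume "x \<in> \<T> (T_alpha \<alpha>) g h"
    then show "?f h (inv g \<otimes> inv h) (\<P> (T_alpha \<alpha>) g h x) = \<P> (T_alpha \<beta>) g h (?f g h x)"
      using G CS2_rotate[OF \<sigma> G] by (auto simp: T_alpha_simps closed G_simps act_simps)
  }
  {
    fix x assume "x \<in> \<T> (T_alpha \<alpha>) g h"
    then show "?f (inv g) (h \<otimes> g) (\<Q> (T_alpha \<alpha>) g h x) = \<Q> (T_alpha \<beta>) g h (?f g h x)"
      using G CS2_reflect[OF \<sigma> G] by (auto simp: T_alpha_simps closed G_simps act_simps minus_add)
  }
  {
    fix k a b c assume k: "k \<in> carrier G" and "a \<in> \<T> (T_alpha \<alpha>) g (inv h)"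
      "b \<in> \<T> (T_alpha \<alpha>) h (inv k)" "c \<in> \<T> (T_alpha \<alpha>) (inv h \<otimes> g) (inv k \<otimes> h)"
    then obtain a' b' c' where [simp]: "a = (a', (g, inv h))" "b = (b', (h, inv k))"
      "c = (c', (inv h \<otimes> g, inv k \<otimes> h))" "a' \<in> carrier A" "b' \<in> carrier A" "c' \<in> carrier A"
      by (auto simp: T_alpha_T)
    \<comment> \<open>Both sides of the law for m share these fibre coordinates; what remains is the
      identity of \<open>cohomologous_iff_commutes_m\<close>.\<close>
    let ?u = "a' \<oplus>\<^bsub>A\<^esub> act (inv g \<otimes> h) b' \<oplus>\<^bsub>A\<^esub> c'"
    have "?f g (inv k) (\<m> (T_alpha \<alpha>) g h k a b c) =
        (?u \<oplus>\<^bsub>A\<^esub> (\<alpha> [inv g \<otimes> h, inv h \<otimes> k, inv k] \<oplus>\<^bsub>A\<^esub> \<sigma> [inv g \<otimes> k, inv k]), (g, inv k))"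
      using G k by (simp add: T_alpha_ops closed a_ac)
    also have "\<alpha> [inv g \<otimes> h, inv h \<otimes> k, inv k] \<oplus>\<^bsub>A\<^esub> \<sigma> [inv g \<otimes> k, inv k] =
      \<sigma> [inv g \<otimes> h, inv h] \<oplus>\<^bsub>A\<^esub> act (inv g \<otimes> h) (\<sigma> [inv h \<otimes> k, inv k])
        \<oplus>\<^bsub>A\<^esub> \<sigma> [inv g \<otimes> k, inv k \<otimes> h] \<oplus>\<^bsub>A\<^esub> \<beta> [inv g \<otimes> h, inv h \<otimes> k, inv k]"
      using coh G k cohomologous_iff_commutes_m[OF \<sigma> ZS3_D(1)[OF \<alpha>] ZS3_D(1)[OF \<beta>]] by blast
    also have "(?u \<oplus>\<^bsub>A\<^esub> \<dots>, (g, inv k)) =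
        \<m> (T_alpha \<beta>) g h k (?f g (inv h) a) (?f h (inv k) b) (?f (inv h \<otimes> g) (inv k \<otimes> h) c)"
      using G k by (simp add: T_alpha_ops closed G_simps act_simps a_ac)
    finally show "?f g (inv k) (\<m> (T_alpha \<alpha>) g h k a b c) =
        \<m> (T_alpha \<beta>) g h k (?f g (inv h) a) (?f h (inv k) b) (?f (inv h \<otimes> g) (inv k \<otimes> h) c)" .
  }
qed

text \<open>Both sides of each commutation law are affine in the fibre coordinates with the same
  linear part, so evaluating at zero retains all the information. The laws for \<open>P\<close> and
  \<open>Q\<close> come first, because reading the law for m as a coboundary equation already uses
  that \<sigma> alternates.\<close>

lemma cohomologous_of_delta_group_iso:
  assumes \<alpha>: "\<alpha> \<in> carrier ZS3" and \<beta>: "\<beta> \<in> carrier ZS3"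
    and iso: "delta_group_iso G (T_alpha \<alpha>) (T_alpha \<beta>) f"
    and \<sigma>: "\<sigma> \<in> carrier (cochains 2)"
    and f: "\<And>a g h. \<lbrakk>a \<in> carrier A; g \<in> carrier G; h \<in> carrier G\<rbrakk>
      \<Longrightarrow> f g h (a, (g, h)) = (a \<oplus>\<^bsub>A\<^esub> \<sigma> [inv g \<otimes> inv h, h], (g, h))"
  shows "\<sigma> \<in> CS2" "cohomologous \<sigma> \<alpha> \<beta>"
proof -
  note closed = ZS3_closed[OF \<alpha>] ZS3_closed[OF \<beta>] cochain_closed[OF \<sigma>]
  show CS2: "\<sigma> \<in> CS2"
  proof (rule CS2_I[OF \<sigma>])
    fix g h assume G: "g \<in> carrier G" "h \<in> carrier G"
    have "(\<zero>\<^bsub>A\<^esub>, (g, h)) \<in> \<T> (T_alpha \<alpha>) g h"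
      by (simp add: T_alpha_T)
    note commutes = delta_group_iso.commutes_P[OF iso G this] delta_group_iso.commutes_Q[OF iso G this]
    show "act g (\<sigma> [inv g \<otimes> inv h, h]) = \<sigma> [g, inv g \<otimes> inv h]"
      using commutes(1) G by (simp add: T_alpha_ops f closed G_simps)
    show "\<ominus>\<^bsub>A\<^esub> act g (\<sigma> [inv g \<otimes> inv h, h]) = \<sigma> [inv h, h \<otimes> g]"
      using commutes(2) G by (simp add: T_alpha_ops f closed G_simps)
  qed
  show "cohomologous \<sigma> \<alpha> \<beta>"
    unfolding cohomologous_iff_commutes_m[OF CS2 ZS3_D(1)[OF \<alpha>] ZS3_D(1)[OF \<beta>]]
  proof (intro ballI)
    fix g h k assume G: "g \<in> carrier G" "h \<in> carrier G" "k \<in> carrier G"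
    have "(\<zero>\<^bsub>A\<^esub>, (g, h)) \<in> \<T> (T_alpha \<alpha>) g h" for g h
      by (simp add: T_alpha_T)
    from delta_group_iso.commutes_m[OF iso G this this this]
    show "\<alpha> [inv g \<otimes> h, inv h \<otimes> k, inv k] \<oplus>\<^bsub>A\<^esub> \<sigma> [inv g \<otimes> k, inv k] =
      \<sigma> [inv g \<otimes> h, inv h] \<oplus>\<^bsub>A\<^esub> act (inv g \<otimes> h) (\<sigma> [inv h \<otimes> k, inv k])
        \<oplus>\<^bsub>A\<^esub> \<sigma> [inv g \<otimes> k, inv k \<otimes> h] \<oplus>\<^bsub>A\<^esub> \<beta> [inv g \<otimes> h, inv h \<otimes> k, inv k]"
      using G by (simp add: T_alpha_ops f closed G_simps)
  qed
qed

lemma delta_group_iso_iff_HS3_class_eq: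
  assumes \<alpha>: "\<alpha> \<in> carrier ZS3" and \<beta>: "\<beta> \<in> carrier ZS3"
  shows "(\<exists>f \<sigma>. delta_group_iso G (T_alpha \<alpha>) (T_alpha \<beta>) f \<and> \<sigma> \<in> carrier (cochains 2) \<and>
      (\<forall>a\<in>carrier A. \<forall>g\<in>carrier G. \<forall>h\<in>carrier G.
        f g (inv h) (a, (g, inv h)) = (a \<oplus>\<^bsub>A\<^esub> \<sigma> [inv g \<otimes> h, inv h], (g, inv h))))
    \<longleftrightarrow> HS3_class \<alpha> = HS3_class \<beta>" (is "?iso \<longleftrightarrow> _")
proof -
  have "?iso \<longleftrightarrow> (\<exists>\<sigma>\<in>CS2. cohomologous \<sigma> \<alpha> \<beta>)"
  proof
    assume ?iso
    then obtain f \<sigma> where iso: "delta_group_iso G (T_alpha \<alpha>) (T_alpha \<beta>) f"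
      and \<sigma>: "\<sigma> \<in> carrier (cochains 2)"
      and f: "\<And>a g h. \<lbrakk>a \<in> carrier A; g \<in> carrier G; h \<in> carrier G\<rbrakk>
        \<Longrightarrow> f g (inv h) (a, (g, inv h)) = (a \<oplus>\<^bsub>A\<^esub> \<sigma> [inv g \<otimes> h, inv h], (g, inv h))"
      by blast
    \<comment> \<open>Every second index is the inverse of some element, so the formula on the
      fibres T(g, h^-1) covers all fibres.\<close>
    have "f g h (a, (g, h)) = (a \<oplus>\<^bsub>A\<^esub> \<sigma> [inv g \<otimes> inv h, h], (g, h))"
      if "a \<in> carrier A" "g \<in> carrier G" "h \<in> carrier G" for a g h
      using f[of a g "inv h"] that by simp
    with cohomologous_of_delta_group_iso[OF \<alpha> \<beta> iso \<sigma>] show "\<exists>\<sigma>\<in>CS2. cohomologous \<sigma> \<alpha> \<beta>"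
      by blast
  next
    assume "\<exists>\<sigma>\<in>CS2. cohomologous \<sigma> \<alpha> \<beta>"
    then obtain \<sigma> where "\<sigma> \<in> CS2" "cohomologous \<sigma> \<alpha> \<beta>"
      by blast
    then show ?iso
      using delta_group_iso_translation[OF \<alpha> \<beta>] CS2_D(1) by (intro exI conjI) auto
  qed
  then show ?thesis
    by (simp add: HS3_class_eq_iff ZS3_D(1) \<alpha> \<beta>)
qed

end

theorem theorem4p3:
  fixes G :: "('g, 'm) monoid_scheme"
    and A :: "('a, 'r) ring_scheme"
    and act :: "'g \<Rightarrow> 'a \<Rightarrow> 'a"
    and \<alpha> \<beta> :: "'g list \<Rightarrow> 'a"
  assumes "G_module G A act"
    and "\<alpha> \<in> carrier (G_module.ZS3 G A act)"
    and "\<beta> \<in> carrier (G_module.ZS3 G A act)"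
  shows "(\<exists>f \<sigma>. delta_group_iso G (G_module.T_alpha G A act \<alpha>) (G_module.T_alpha G A act \<beta>) f \<and>
            \<sigma> \<in> carrier (G_module.cochains G A 2) \<and>
            (\<forall>a\<in>carrier A. \<forall>g\<in>carrier G. \<forall>h\<in>carrier G.
              f g (inv\<^bsub>G\<^esub> h) (a, (g, inv\<^bsub>G\<^esub> h)) =
                (a \<oplus>\<^bsub>A\<^esub> \<sigma> [inv\<^bsub>G\<^esub> g \<otimes>\<^bsub>G\<^esub> h, inv\<^bsub>G\<^esub> h], (g, inv\<^bsub>G\<^esub> h))))
        \<longleftrightarrow> G_module.HS3_class G A act \<alpha> = G_module.HS3_class G A act \<beta>"
  using G_module.delta_group_iso_iff_HS3_class_eq[OF assms] .

end
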